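(* Let $1 \le k \le n$ be integers, let $\{e_1,\dots,e_n\}$ be the standard basis of $\mathbb{R}^n$, and let $A(k,n) \subset G_k(\mathbb{R}^n)^\sim$ be the set of all oriented $k$-dimensional linear subspaces $(\mathrm{Span}\{e_{i_1},\dots,e_{i_k}\},\sigma)$ with $1 \le i_1 < \cdots < i_k \le n$ and $\sigma$ either of the two orientations of $\mathrm{Span}\{e_{i_1},\dots,e_{i_k}\}$. Then $A(k,n)$ is a subquandle of the quandle $G_k(\mathbb{R}^n)^\sim$. Furthermore, $A(k,n)$ (with the restricted quandle structure) is a homogeneous disconnected quandle, and its inner automorphism group is abelian.
   Context: A quandle is a pair $(X,s)$ of a set $X$ and a map $s : X \to \mathrm{Map}(X,X)$, $x \mapsto s_x$, such that (Q1) $s_x(x)=x$ for all $x$; (Q2) every $s_x$ is bijective; (Q3) $s_x\circ s_y = s_{s_x(y)}\circ s_x$ for all $x,y\in X$. A nonempty subset $A\subset X$ is a subquandle if $s_a^{\pm1}(A)\subset A$ for every $a\in A$; it is then a quandle with the restricted structure. A map $f:X\to Y$ between quandles $(X,s^X)$, $(Y,s^Y)$ is a homomorphism if $f\circ s^X_x = s^Y_{f(x)}\circ f$ for all $x\in X$; a bijective homomorphism is an isomorphism, and an isomorphism from $(X,s)$ to itself is an automorphism. $\mathrm{Aut}(X,s)$ is the group of automorphisms. The inner automorphism group $\mathrm{Inn}(X,s)$ is the group generated by $\{s_x \mid x\in X\}$. The quandle is homogeneous if $\mathrm{Aut}(X,s)$ acts transitively on $X$, connected if $\mathrm{Inn}(X,s)$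 acts transitively on $X$, and disconnected if it is not connected. The oriented real Grassmannian $G_k(\mathbb{R}^n)^\sim$ is the set of pairs $(V,\sigma)$ with $V$ a $k$-dimensional linear subspace of $\mathbb{R}^n$ and $\sigma$ an orientation of $V$, i.e. an equivalence class $[(v_1,\dots,v_k)]$ of ordered bases of $V$, two ordered bases being equivalent if their change-of-basis matrix has positive determinant. For a linear subspace $V\subset\mathbb{R}^n$, let $r_V$ be the reflection with respect to $V$: $r_V(x+y)=x-y$ for $x\in V$, $y\in V^\perp$. The quandle structure on $G_k(\mathbb{R}^n)^\sim$ is $s_{(V,\sigma)}(W,[(w_1,\dots,w_k)]) = (r_V(W),[(r_V(w_1),\dots,r_V(w_k))])$. *)

theory Defs
  imports
    "HOL-Analysis.Analysis"
    "HOL-Algebra.Bij"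
    "HOL-Algebra.Generated_Groups"
    "Jordan_Normal_Form.Determinant"
begin

hide_const (open) Determinants.det Finite_Cartesian_Product.vec

section \<open>Quandles\<close>

text \<open>A quandle has an explicit carrier \<open>X\<close>; the values of \<open>s x y\<close> outside \<open>X\<close> are irrelevant.
  Hence a subquandle with its restricted structure is again presented by the same map \<open>s\<close>.\<close>

definition quandle :: "'a set \<Rightarrow> ('a \<Rightarrow> 'a \<Rightarrow> 'a) \<Rightarrow> bool" where
  "quandle X s \<longleftrightarrow>
     (\<forall>x\<in>X. s x x = x) \<and>
     (\<forall>x\<in>X. bij_betw (s x) X X) \<and>
     (\<forall>x\<in>X. \<forall>y\<in>X. \<forall>z\<in>X. s x (s y z) = s (s x y) (s x z))"

definition subquandle :: "'a set \<Rightarrow> 'a set \<Rightarrow> ('a \<Rightarrow> 'a \<Rightarrow> 'a) \<Rightarrow> bool" where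
  "subquandle A X s \<longleftrightarrow>
     quandle X s \<and> A \<noteq> {} \<and> A \<subseteq> X \<and>
     (\<forall>a\<in>A. s a ` A \<subseteq> A \<and> inv_into X (s a) ` A \<subseteq> A)"

definition quandle_hom ::
  "'a set \<Rightarrow> ('a \<Rightarrow> 'a \<Rightarrow> 'a) \<Rightarrow> 'b set \<Rightarrow> ('b \<Rightarrow> 'b \<Rightarrow> 'b) \<Rightarrow> ('a \<Rightarrow> 'b) \<Rightarrow> bool" where
  "quandle_hom X s Y t f \<longleftrightarrow>
     f \<in> X \<rightarrow> Y \<and> (\<forall>x\<in>X. \<forall>z\<in>X. f (s x z) = t (f x) (f z))"

definition quandle_Aut :: "'a set \<Rightarrow> ('a \<Rightarrow> 'a \<Rightarrow> 'a) \<Rightarrow> ('a \<Rightarrow> 'a) monoid" where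
  "quandle_Aut X s = BijGroup X \<lparr>carrier := {f \<in> Bij X. quandle_hom X s X s f}\<rparr>"

text \<open>The maps \<open>s x\<close> are restricted to \<open>X\<close> because elements of \<^const>\<open>Bij\<close> are extensional.\<close>

definition quandle_Inn :: "'a set \<Rightarrow> ('a \<Rightarrow> 'a \<Rightarrow> 'a) \<Rightarrow> ('a \<Rightarrow> 'a) monoid" where
  "quandle_Inn X s =
     BijGroup X \<lparr>carrier := generate (BijGroup X) ((\<lambda>x. restrict (s x) X) ` X)\<rparr>"

definition transitive_on :: "('a \<Rightarrow> 'a) monoid \<Rightarrow> 'a set \<Rightarrow> bool" where
  "transitive_on G X \<longleftrightarrow> (\<forall>x\<in>X. \<forall>y\<in>X. \<exists>g\<in>carrier G. g x = y)"

definition quandle_homogeneous :: "'a set \<Rightarrow> ('a \<Rightarrow> 'a \<Rightarrow> 'a) \<Rightarrow> bool" where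
  "quandle_homogeneous X s \<longleftrightarrow> transitive_on (quandle_Aut X s) X"

definition quandle_connected :: "'a set \<Rightarrow> ('a \<Rightarrow> 'a \<Rightarrow> 'a) \<Rightarrow> bool" where
  "quandle_connected X s \<longleftrightarrow> transitive_on (quandle_Inn X s) X"

abbreviation quandle_disconnected :: "'a set \<Rightarrow> ('a \<Rightarrow> 'a \<Rightarrow> 'a) \<Rightarrow> bool" where
  "quandle_disconnected X s \<equiv> \<not> quandle_connected X s"

section \<open>Oriented real Grassmannians\<close>

definition ordered_bases :: "(real^'n) set \<Rightarrow> (real^'n) list set" where
  "ordered_bases V = {vs. distinct vs \<and> independent (set vs) \<and> span (set vs) = V}"

text \<open>\<open>M\<close> is the change-of-basis matrix; its size is the natural number \<^term>\<open>length vs\<close>,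
  so the matrices of \<^theory>\<open>Jordan_Normal_Form.Matrix\<close> are used.\<close>

definition same_orientation :: "(real^'n) set \<Rightarrow> ((real^'n) list \<times> (real^'n) list) set" where
  "same_orientation V =
     {(vs, ws). vs \<in> ordered_bases V \<and> ws \<in> ordered_bases V \<and>
        (\<exists>M \<in> carrier_mat (length vs) (length vs).
           (\<forall>j<length vs. ws ! j = (\<Sum>i<length vs. M $$ (i, j) *\<^sub>R vs ! i)) \<and>
           Determinant.det M > 0)}"

definition orientations :: "(real^'n) set \<Rightarrow> (real^'n) list set set" where
  "orientations V = ordered_bases V // same_orientation V"

type_synonym 'n oriented_subspace = "(real^'n) set \<times> (real^'n) list set"

definition oriented_Grassmannian :: "nat \<Rightarrow> 'n::finite oriented_subspace set" where
  "oriented_Grassmannian k = {(V, \<sigma>). subspace V \<and> dim V = k \<and> \<sigma> \<in> orientations V}"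

definition subspace_reflection :: "(real^'n) set \<Rightarrow> real^'n \<Rightarrow> real^'n" where
  "subspace_reflection V z =
     (THE w. \<exists>x\<in>V. \<exists>y\<in>orthogonal_comp V. z = x + y \<and> w = x - y)"

text \<open>The union ranges over all representatives \<open>ws\<close> of \<open>\<tau>\<close>; for subspaces \<open>V\<close>, \<open>W\<close> and
  \<open>\<tau> \<in> orientations W\<close> all its members coincide, being the class of the reflected basis.\<close>

definition Grassmannian_op ::
  "'n::finite oriented_subspace \<Rightarrow> 'n oriented_subspace \<Rightarrow> 'n oriented_subspace" where
  "Grassmannian_op = (\<lambda>(V, \<sigma>) (W, \<tau>).
     (subspace_reflection V ` W,
      \<Union>ws\<in>\<tau>. same_orientation (subspace_reflection V ` W) `` {map (subspace_reflection V) ws}))"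

text \<open>Choosing indices \<open>i\<^sub>1 < \<dots> < i\<^sub>k\<close> is choosing a \<open>k\<close>-element set \<open>I\<close> of indices.\<close>

definition coordinate_subspaces :: "nat \<Rightarrow> 'n::finite oriented_subspace set" where
  "coordinate_subspaces k =
     {(span ((\<lambda>i. axis i 1) ` I), \<sigma>) | I \<sigma>.
        card I = k \<and> \<sigma> \<in> orientations (span ((\<lambda>i. axis i 1) ` I))}"

end

theory Submission
  imports Defs
begin

text \<open>
  Everything rests on one observation: an invertible linear map \<open>g\<close> moves oriented subspaces by
  \<open>(V, \<sigma>) \<mapsto> (g ` V, map g ` \<sigma>)\<close> (\<open>move\<close>, \<open>Grassmannian_op_eq_move\<close>), and \<open>s\<close> at \<open>(V, \<sigma>)\<close> is the move by the reflection
  \<open>r\<^sub>V\<close>, whatever \<open>\<sigma>\<close> is. The quandle axioms then become identities between linear maps: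
  \<open>r\<^sub>V\<close> fixes \<open>V\<close> pointwise, is an involution, and satisfies \<open>g \<circ> r\<^sub>V = r\<^bsub>g V\<^esub> \<circ> g\<close> for orthogonal
  \<open>g\<close>. The last identity says more generally that every orthogonal map moves the Grassmannian by
  quandle automorphisms.

  For a coordinate subspace, \<open>r\<^sub>V\<close> changes the signs of some coordinates. Such maps send every
  coordinate subspace onto itself, which gives the subquandle, and they commute with each other,
  so that the generators of the inner automorphism group commute.

  The operation therefore never changes the underlying subspace. For \<open>k < n\<close> there are several
  coordinate subspaces, so the quandle is not connected. For \<open>k = n\<close> there is only one, but its
  reflection is the identity and it carries two orientations, so again there are two orbits.

  Homogeneity comes from signed permutation matrices. A permutation of the coordinates moves the
  index set \<open>I\<close> onto any other index set of the same size; if the orientation comes out wrong, a sign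
  change of one coordinate in the target (possible as \<open>k \<ge> 1\<close>) exchanges the two orientations.
  That there are exactly two, and that the sign change swaps them, is a computation with
  change-of-basis matrices (\<open>coordinate_span_orientations\<close>).
\<close>

hide_const (open) Matrix.orthogonal

section \<open>Change of basis and orientations\<close>

text \<open>As a matrix product: the row of vectors \<open>vs\<close> times \<open>M\<close>.\<close>
definition basis_change :: "('a::real_vector) list \<Rightarrow> real mat \<Rightarrow> 'a list" where
  "basis_change vs M =
     map (\<lambda>j. \<Sum>i<length vs. M $$ (i, j) *\<^sub>R vs ! i) [0..<length vs]"

lemma length_basis_change [simp]: "length (basis_change vs M) = length vs"
  by (simp add: basis_change_def)

lemma nth_basis_change:
  "j < length vs \<Longrightarrow> basis_change vs M ! j = (\<Sum>i<length vs. M $$ (i, j) *\<^sub>R vs ! i)"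
  by (simp add: basis_change_def)

lemma map_basis_change:
  "linear g \<Longrightarrow> map g (basis_change vs M) = basis_change (map g vs) M"
  by (rule nth_equalityI) (simp_all add: nth_basis_change linear_sum linear_scale)

lemma basis_change_one: "basis_change vs (1\<^sub>m (length vs)) = vs"
proof (rule nth_equalityI)
  fix j assume "j < length (basis_change vs (1\<^sub>m (length vs)))"
  then have j: "j < length vs" by simp
  have "(\<Sum>i<length vs. 1\<^sub>m (length vs) $$ (i, j) *\<^sub>R vs ! i)
      = (\<Sum>i<length vs. if i = j then vs ! i else 0)"
    using j by (intro sum.cong) auto
  then show "basis_change vs (1\<^sub>m (length vs)) ! j = vs ! j"
    using j by (simp add: nth_basis_change)
qed simp

lemma basis_change_mult:
  assumes "M \<in> carrier_mat (length vs) (length vs)" "N \<in> carrier_mat (length vs) (length vs)"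
  shows "basis_change (basis_change vs M) N = basis_change vs (M * N)"
proof (rule nth_equalityI)
  fix j assume "j < length (basis_change (basis_change vs M) N)"
  then have j: "j < length vs" by simp
  let ?n = "length vs"
  have "basis_change (basis_change vs M) N ! j
      = (\<Sum>i<?n. N $$ (i, j) *\<^sub>R (\<Sum>l<?n. M $$ (l, i) *\<^sub>R vs ! l))"
    using j by (simp add: nth_basis_change)
  also have "\<dots> = (\<Sum>l<?n. \<Sum>i<?n. (M $$ (l, i) * N $$ (i, j)) *\<^sub>R vs ! l)"
    by (subst sum.swap) (simp add: scaleR_sum_right mult.commute)
  also have "\<dots> = (\<Sum>l<?n. (M * N) $$ (l, j) *\<^sub>R vs ! l)"
    using assms j
    by (intro sum.cong) (auto simp: scalar_prod_def scaleR_sum_left atLeast0LessThan)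
  also have "\<dots> = basis_change vs (M * N) ! j"
    using j by (simp add: nth_basis_change)
  finally show "basis_change (basis_change vs M) N ! j = basis_change vs (M * N) ! j" .
qed simp

lemma basis_change_inject:
  assumes vs: "distinct vs" "independent (set vs)"
    and MN: "M \<in> carrier_mat (length vs) (length vs)" "N \<in> carrier_mat (length vs) (length vs)"
    and eq: "basis_change vs M = basis_change vs N"
  shows "M = N"
proof (rule eq_matI)
  let ?n = "length vs"
  fix i j assume "i < dim_row N" "j < dim_col N"
  then have i: "i < ?n" and j: "j < ?n" using MN by auto
  have bij: "bij_betw ((!) vs) {..<?n} (set vs)"
    using vs(1) by (intro bij_betw_nth) auto
  define c where "c v = (let l = inv_into {..<?n} ((!) vs) v in M $$ (l, j) - N $$ (l, j))" for v
  have c: "c (vs ! l) = M $$ (l, j) - N $$ (l, j)" if "l < ?n" for l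
    using bij that by (simp add: c_def Let_def bij_betw_inv_into_left)
  have "(\<Sum>v\<in>set vs. c v *\<^sub>R v) = (\<Sum>l<?n. c (vs ! l) *\<^sub>R vs ! l)"
    by (rule sum.reindex_bij_betw[OF bij, symmetric])
  also have "\<dots> = basis_change vs M ! j - basis_change vs N ! j"
    using j by (simp add: nth_basis_change c scaleR_diff_left sum_subtractf)
  also have "\<dots> = 0" by (simp add: eq)
  finally have "c (vs ! i) = 0"
    using vs(2) i by (intro independentD[OF vs(2), of "set vs" c]) auto
  then show "M $$ (i, j) = N $$ (i, j)" using c[OF i] by simp
qed (use MN in auto)

lemma ex_basis_change:
  assumes vs: "distinct vs" and ws: "set ws \<subseteq> span (set vs)" "length ws = length vs"
  obtains M where "M \<in> carrier_mat (length vs) (length vs)" "ws = basis_change vs M"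
proof -
  let ?n = "length vs"
  have bij: "bij_betw ((!) vs) {..<?n} (set vs)"
    using vs by (intro bij_betw_nth) auto
  have "\<exists>c. w = (\<Sum>v\<in>set vs. c v *\<^sub>R v)" if "w \<in> set ws" for w
    using that ws(1) by (auto simp: span_finite)
  then obtain c where c: "\<And>w. w \<in> set ws \<Longrightarrow> w = (\<Sum>v\<in>set vs. c w v *\<^sub>R v)"
    by metis
  define M where "M = mat ?n ?n (\<lambda>(i, j). c (ws ! j) (vs ! i))"
  have "ws = basis_change vs M"
  proof (rule nth_equalityI)
    fix j assume j: "j < length ws"
    have "ws ! j = (\<Sum>v\<in>set vs. c (ws ! j) v *\<^sub>R v)"
      using j by (intro c) auto
    also have "\<dots> = (\<Sum>l<?n. c (ws ! j) (vs ! l) *\<^sub>R vs ! l)"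
      by (rule sum.reindex_bij_betw[OF bij, symmetric])
    also have "\<dots> = basis_change vs M ! j"
      using j ws(2) by (simp add: nth_basis_change M_def)
    finally show "ws ! j = basis_change vs M ! j" .
  qed (simp add: ws(2))
  moreover have "M \<in> carrier_mat ?n ?n" by (simp add: M_def)
  ultimately show thesis by (intro that)
qed

lemma length_ordered_bases:
  assumes "vs \<in> ordered_bases V" shows "length vs = dim V"
proof -
  have vs: "distinct vs" "independent (set vs)" "span (set vs) = V"
    using assms by (simp_all add: ordered_bases_def)
  show ?thesis
    using dim_span_eq_card_independent[OF vs(2)] vs(3) distinct_card[OF vs(1)] by simp
qed

lemma same_orientation_iff:
  "(vs, ws) \<in> same_orientation V \<longleftrightarrow>
     vs \<in> ordered_bases V \<and> ws \<in> ordered_bases V \<and>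
     (\<exists>M\<in>carrier_mat (dim V) (dim V). ws = basis_change vs M \<and> Determinant.det M > 0)"
proof -
  have "(\<forall>j<length vs. ws ! j = (\<Sum>i<length vs. M $$ (i, j) *\<^sub>R vs ! i)) \<longleftrightarrow> ws = basis_change vs M"
    if "vs \<in> ordered_bases V" "ws \<in> ordered_bases V" for M
    using that[THEN length_ordered_bases]
    by (auto simp: list_eq_iff_nth_eq nth_basis_change)
  then have "vs \<in> ordered_bases V \<and> ws \<in> ordered_bases V \<and>
      (\<exists>M\<in>carrier_mat (length vs) (length vs).
         (\<forall>j<length vs. ws ! j = (\<Sum>i<length vs. M $$ (i, j) *\<^sub>R vs ! i)) \<and> Determinant.det M > 0)
    \<longleftrightarrow> vs \<in> ordered_bases V \<and> ws \<in> ordered_bases V \<and>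
      (\<exists>M\<in>carrier_mat (length vs) (length vs). ws = basis_change vs M \<and> Determinant.det M > 0)"
    by (intro conj_cong refl bex_cong) simp_all
  moreover have "length vs = dim V" if "vs \<in> ordered_bases V"
    using that by (rule length_ordered_bases)
  ultimately show ?thesis
    unfolding same_orientation_def mem_Collect_eq prod.case by auto
qed

text \<open>The two change-of-basis matrices between a pair of bases are inverse to each other, because
  coordinates with respect to a basis are unique. Hence their determinants are nonzero and of equal
  sign, which gives the symmetry of \<^const>\<open>same_orientation\<close>.\<close>
lemma ordered_bases_basis_change:
  assumes vs: "vs \<in> ordered_bases V" and ws: "ws \<in> ordered_bases V"
  obtains M N where "M \<in> carrier_mat (dim V) (dim V)" "N \<in> carrier_mat (dim V) (dim V)"
    "ws = basis_change vs M" "vs = basis_change ws N"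
    "Determinant.det M * Determinant.det N = 1"
proof -
  note len = vs[THEN length_ordered_bases] ws[THEN length_ordered_bases]
  have V: "distinct vs" "independent (set vs)" "distinct ws"
    "set vs \<subseteq> span (set ws)" "set ws \<subseteq> span (set vs)"
    using vs ws span_superset by (auto simp: ordered_bases_def)
  obtain M where M: "M \<in> carrier_mat (dim V) (dim V)" "ws = basis_change vs M"
    using ex_basis_change[of vs ws] V len by auto
  obtain N where N: "N \<in> carrier_mat (dim V) (dim V)" "vs = basis_change ws N"
    using ex_basis_change[of ws vs] V len by auto
  have "basis_change vs (M * N) = basis_change (basis_change vs M) N"
    using M(1) N(1) len by (simp add: basis_change_mult)
  also have "\<dots> = basis_change vs (1\<^sub>m (length vs))"
    unfolding basis_change_one M(2)[symmetric] N(2)[symmetric] ..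
  finally have "basis_change vs (M * N) = basis_change vs (1\<^sub>m (length vs))" .
  then have "M * N = 1\<^sub>m (dim V)"
    using basis_change_inject[of vs "M * N" "1\<^sub>m (dim V)"] V(1,2) M(1) N(1) len by simp
  then have "Determinant.det M * Determinant.det N = 1"
    using det_mult[OF M(1) N(1)] by simp
  with M N that show thesis by blast
qed

lemma equiv_same_orientation: "equiv (ordered_bases V) (same_orientation V)"
proof (rule equivI)
  show "same_orientation V \<subseteq> ordered_bases V \<times> ordered_bases V"
    by (auto simp: same_orientation_def)
  show "refl_on (ordered_bases V) (same_orientation V)"
  proof (rule refl_onI)
    fix vs assume vs: "vs \<in> ordered_bases V"
    then have "vs = basis_change vs (1\<^sub>m (dim V))"
      using basis_change_one[of vs] by (simp add: length_ordered_bases)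
    then show "(vs, vs) \<in> same_orientation V"
      using vs by (auto simp: same_orientation_iff intro!: bexI[of _ "1\<^sub>m (dim V)"])
  qed
  show "sym (same_orientation V)"
  proof (rule symI)
    fix vs ws assume *: "(vs, ws) \<in> same_orientation V"
    then have vs: "vs \<in> ordered_bases V" and ws: "ws \<in> ordered_bases V"
      by (auto simp: same_orientation_iff)
    note len = vs[THEN length_ordered_bases] ws[THEN length_ordered_bases]
    obtain M N where MN: "M \<in> carrier_mat (dim V) (dim V)" "N \<in> carrier_mat (dim V) (dim V)"
      "ws = basis_change vs M" "vs = basis_change ws N"
      "Determinant.det M * Determinant.det N = 1"
      using ordered_bases_basis_change[OF vs ws] .
    obtain M' where M': "M' \<in> carrier_mat (dim V) (dim V)" "ws = basis_change vs M'"
      "Determinant.det M' > 0"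
      using * by (auto simp: same_orientation_iff)
    have "M' = M"
      using basis_change_inject[of vs M' M] MN(1,3) M'(1,2) vs len(1)
      by (metis (mono_tags, lifting) mem_Collect_eq ordered_bases_def)
    with MN(5) M'(3) have "Determinant.det N > 0"
      using zero_less_mult_pos[of "Determinant.det M" "Determinant.det N"] by simp
    with MN vs ws show "(ws, vs) \<in> same_orientation V"
      by (auto simp: same_orientation_iff)
  qed
  show "trans (same_orientation V)"
  proof (rule transI)
    fix us vs ws assume 1: "(us, vs) \<in> same_orientation V" and 2: "(vs, ws) \<in> same_orientation V"
    obtain M where M: "M \<in> carrier_mat (dim V) (dim V)" "vs = basis_change us M"
      "Determinant.det M > 0"
      using 1 by (auto simp: same_orientation_iff)
    obtain N where N: "N \<in> carrier_mat (dim V) (dim V)" "ws = basis_change vs N"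
      "Determinant.det N > 0"
      using 2 by (auto simp: same_orientation_iff)
    have us: "us \<in> ordered_bases V" "ws \<in> ordered_bases V"
      using 1 2 by (auto simp: same_orientation_iff)
    have "ws = basis_change us (M * N)"
      using M N us[THEN length_ordered_bases] by (simp add: basis_change_mult)
    moreover have "Determinant.det (M * N) > 0"
      using M N by (simp add: det_mult)
    ultimately show "(us, ws) \<in> same_orientation V"
      using us M N by (auto simp: same_orientation_iff intro!: bexI[of _ "M * N"])
  qed
qed



section \<open>Linear isomorphisms act on oriented subspaces\<close>

definition move :: "(real^'n \<Rightarrow> real^'n) \<Rightarrow> 'n oriented_subspace \<Rightarrow> 'n oriented_subspace" where
  "move g = (\<lambda>(V, \<sigma>). (g ` V, map g ` \<sigma>))"

lemma move_move: "move g (move h x) = move (g \<circ> h) x"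
  by (simp add: move_def image_comp map_fun_def comp_def split: prod.split)

lemma ordered_bases_image:
  fixes g :: "real^'n \<Rightarrow> real^'n"
  assumes g: "linear g" "inj g" and vs: "vs \<in> ordered_bases V"
  shows "map g vs \<in> ordered_bases (g ` V)"
proof -
  have "distinct (map g vs)"
    using vs g(2) by (simp add: ordered_bases_def distinct_map inj_on_subset[OF _ subset_UNIV])
  moreover have "independent (set (map g vs))"
    using vs linear_independent_injective_image[OF g(1), of "set vs"] inj_on_subset[OF g(2)]
    by (simp add: ordered_bases_def)
  moreover have "span (set (map g vs)) = g ` V"
    using vs g(1) by (simp add: ordered_bases_def linear_span_image)
  ultimately show ?thesis by (simp add: ordered_bases_def)
qed

lemma same_orientation_image:
  fixes g :: "real^'n \<Rightarrow> real^'n"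
  assumes g: "linear g" "inj g" and vs: "(vs, ws) \<in> same_orientation V"
  shows "(map g vs, map g ws) \<in> same_orientation (g ` V)"
proof -
  obtain M where M: "M \<in> carrier_mat (dim V) (dim V)" "ws = basis_change vs M"
      "Determinant.det M > 0"
    using vs by (auto simp: same_orientation_iff)
  have "dim (g ` V) = dim V"
    using g by (intro dim_image_eq) (auto intro: inj_on_subset)
  moreover have "vs \<in> ordered_bases V" "ws \<in> ordered_bases V"
    using vs by (auto simp: same_orientation_iff)
  moreover have "map g ws = basis_change (map g vs) M"
    using M(2) g(1) by (simp add: map_basis_change)
  ultimately show ?thesis
    using M(1,3) ordered_bases_image[OF g] unfolding same_orientation_iff by metis
qed

text \<open>The inclusion from right to left transports by \<open>g\<close>; the other one transports back by the
  inverse of \<open>g\<close>, which is again linear and injective.\<close>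
lemma same_orientation_image_class:
  fixes g :: "real^'n \<Rightarrow> real^'n"
  assumes g: "linear g" "inj g" and vs: "vs \<in> ordered_bases V"
  shows "same_orientation (g ` V) `` {map g vs} = map g ` (same_orientation V `` {vs})"
proof
  show "map g ` (same_orientation V `` {vs}) \<subseteq> same_orientation (g ` V) `` {map g vs}"
    using same_orientation_image[OF g] by auto
  show "same_orientation (g ` V) `` {map g vs} \<subseteq> map g ` (same_orientation V `` {vs})"
  proof
    fix us assume us: "us \<in> same_orientation (g ` V) `` {map g vs}"
    obtain h where h: "linear h" "h \<circ> g = id"
      using linear_injective_left_inverse[OF g] by blast
    have "bij g"
      using g linear_injective_imp_surjective by (auto simp: bij_def)
    then have h': "g \<circ> h = id"
      using h(2) by (metis bij_is_surj comp_assoc comp_id fun.map_id surj_iff)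
    have "inj h" using h' by (metis inj_on_id inj_on_imageI2)
    then have "(map h (map g vs), map h us) \<in> same_orientation (h ` g ` V)"
      using us h(1) by (intro same_orientation_image) auto
    then have "(vs, map h us) \<in> same_orientation V"
      using h(2) by (simp add: image_comp comp_def id_def fun_eq_iff)
    moreover have "us = map g (map h us)" using h' by simp
    ultimately show "us \<in> map g ` (same_orientation V `` {vs})" by blast
  qed
qed

lemma orientations_image:
  fixes g :: "real^'n \<Rightarrow> real^'n"
  assumes g: "linear g" "inj g" and \<sigma>: "\<sigma> \<in> orientations V"
  shows "map g ` \<sigma> \<in> orientations (g ` V)"
proof -
  obtain vs where vs: "vs \<in> ordered_bases V" "\<sigma> = same_orientation V `` {vs}"
    using \<sigma> by (auto simp: orientations_def elim: quotientE)
  show ?thesis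
    using quotientI[OF ordered_bases_image[OF g vs(1)], of "same_orientation (g ` V)"]
      same_orientation_image_class[OF g vs(1)] vs(2)
    by (simp add: orientations_def)
qed

lemma move_in_oriented_Grassmannian:
  assumes g: "linear g" "inj g" and x: "x \<in> oriented_Grassmannian k"
  shows "move g x \<in> oriented_Grassmannian k"
proof -
  have "dim (g ` V) = dim V" for V
    using g by (intro dim_image_eq) (auto intro: inj_on_subset)
  with x g show ?thesis
    by (auto simp: oriented_Grassmannian_def move_def intro: orientations_image linear_subspace_image)
qed

section \<open>The quandle structure in terms of reflections\<close>

lemma subspace_reflection_add:
  assumes "subspace V" "x \<in> V" "y \<in> orthogonal_comp V"
  shows "subspace_reflection V (x + y) = x - y"
  unfolding subspace_reflection_def
proof (rule the_equality)
  show "\<exists>x'\<in>V. \<exists>y'\<in>orthogonal_comp V. x + y = x' + y' \<and> x - y = x' - y'"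
    using assms by blast
next
  fix w assume "\<exists>x'\<in>V. \<exists>y'\<in>orthogonal_comp V. x + y = x' + y' \<and> w = x' - y'"
  then obtain x' y' where *: "x' \<in> V" "y' \<in> orthogonal_comp V" "x + y = x' + y'" "w = x' - y'"
    by blast
  have V: "span V = V" "span (orthogonal_comp V) = orthogonal_comp V"
    using assms(1) by (simp_all add: span_eq_iff subspace_orthogonal_comp)
  have "orthogonal a b" if "a \<in> V" "b \<in> orthogonal_comp V" for a b
    using that by (simp add: orthogonal_comp_def orthogonal_commute)
  then have "x = x' \<and> y = y'"
    using orthogonal_subspace_decomp_unique[of x y x' y' V "orthogonal_comp V"] assms * V
    by metis
  with * show "w = x - y" by simp
qed

lemma orthogonal_decomposition:
  fixes z :: "real^'n"
  assumes "subspace V"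
  obtains x y where "x \<in> V" "y \<in> orthogonal_comp V" "z = x + y"
proof -
  obtain x y where "x \<in> span V" "\<And>w. w \<in> span V \<Longrightarrow> orthogonal y w" "z = x + y"
    using orthogonal_subspace_decomp_exists[of V z] by blast
  moreover have "span V = V" using assms by (simp add: span_eq_iff)
  ultimately have "x \<in> V" "y \<in> orthogonal_comp V" "z = x + y"
    by (auto simp: orthogonal_comp_def orthogonal_commute)
  then show thesis by (rule that)
qed

lemma subspace_reflection_fixes: "subspace V \<Longrightarrow> x \<in> V \<Longrightarrow> subspace_reflection V x = x"
  using subspace_reflection_add[of V x 0] by (simp add: subspace_0 subspace_orthogonal_comp)

lemma subspace_reflection_involution:
  fixes V :: "(real^'n) set"
  assumes V: "subspace V"
  shows "subspace_reflection V \<circ> subspace_reflection V = id"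
proof
  fix z :: "real^'n"
  obtain x y where xy: "x \<in> V" "y \<in> orthogonal_comp V" "z = x + y"
    using orthogonal_decomposition[OF V] .
  have "- y \<in> orthogonal_comp V"
    using xy(2) by (simp add: subspace_orthogonal_comp subspace_neg)
  with xy show "(subspace_reflection V \<circ> subspace_reflection V) z = id z"
    using subspace_reflection_add[OF V, of x y] subspace_reflection_add[OF V, of x "- y"] by simp
qed

lemma orthogonal_transformation_subspace_reflection:
  fixes V :: "(real^'n) set"
  assumes V: "subspace V"
  shows "orthogonal_transformation (subspace_reflection V)"
  unfolding orthogonal_transformation_def
proof (intro conjI allI linearI)
  let ?C = "orthogonal_comp V"
  have C: "subspace ?C" by (rule subspace_orthogonal_comp)
  have orth: "inner x y = 0" "inner y x = 0" if "x \<in> V" "y \<in> ?C" for x y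
    using that by (auto simp: orthogonal_comp_def real_inner_class.orthogonal_def inner_commute)
  note r = subspace_reflection_add[OF V]
  fix a b :: "real^'n" and c :: real
  obtain x y where xy: "x \<in> V" "y \<in> ?C" "a = x + y"
    using orthogonal_decomposition[OF V] .
  obtain x' y' where xy': "x' \<in> V" "y' \<in> ?C" "b = x' + y'"
    using orthogonal_decomposition[OF V] .
  have "subspace_reflection V ((x + x') + (y + y')) = (x + x') - (y + y')"
    using xy xy' V C by (intro r subspace_add)
  then show "subspace_reflection V (a + b) = subspace_reflection V a + subspace_reflection V b"
    by (simp add: xy(3) xy'(3) r[OF xy(1,2)] r[OF xy'(1,2)] add_ac add_diff_add)
  have "subspace_reflection V (c *\<^sub>R x + c *\<^sub>R y) = c *\<^sub>R x - c *\<^sub>R y"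
    using xy V C by (intro r subspace_scale)
  then show "subspace_reflection V (c *\<^sub>R a) = c *\<^sub>R subspace_reflection V a"
    by (simp add: xy(3) r[OF xy(1,2)] scaleR_add_right scaleR_diff_right)
  show "inner (subspace_reflection V a) (subspace_reflection V b) = inner a b"
    using xy xy' orth by (simp add: r inner_diff_left inner_diff_right inner_add_left inner_add_right)
qed

text \<open>An orthogonal map carries the decomposition of a vector along \<open>V\<close> and its complement to the
  decomposition along \<open>g ` V\<close> and its complement.\<close>
lemma subspace_reflection_image:
  fixes V :: "(real^'n) set"
  assumes V: "subspace V" and g: "orthogonal_transformation g"
  shows "subspace_reflection (g ` V) \<circ> g = g \<circ> subspace_reflection V"
proof
  fix z :: "real^'n"
  obtain x y where xy: "x \<in> V" "y \<in> orthogonal_comp V" "z = x + y"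
    using orthogonal_decomposition[OF V] .
  have lin: "linear g" using g by (rule orthogonal_transformation_linear)
  have "g y \<in> orthogonal_comp (g ` V)"
    using xy(2) g by (auto simp: orthogonal_comp_def orthogonal_orthogonal_transformation)
  then show "(subspace_reflection (g ` V) \<circ> g) z = (g \<circ> subspace_reflection V) z"
    using xy subspace_reflection_add[OF V, of x y] lin
      subspace_reflection_add[OF linear_subspace_image[OF lin V], of "g x" "g y"]
    by (simp add: linear_add linear_diff)
qed

text \<open>The union in \<^const>\<open>Grassmannian_op\<close> is over equal sets: each representative \<open>ws\<close> generates
  the same class \<open>\<tau>\<close>, and the class of the reflected basis is the image of \<open>\<tau>\<close>.\<close>
lemma Grassmannian_op_eq_move:
  assumes "x \<in> oriented_Grassmannian k" "y \<in> oriented_Grassmannian l"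
  shows "Grassmannian_op x y = move (subspace_reflection (fst x)) y"
proof -
  obtain V \<sigma> W \<tau> where xy: "x = (V, \<sigma>)" "y = (W, \<tau>)" by (metis surj_pair)
  have V: "subspace V" and \<tau>: "\<tau> \<in> orientations W"
    using assms by (auto simp: xy oriented_Grassmannian_def)
  let ?r = "subspace_reflection V"
  have r: "linear ?r" "inj ?r"
    using orthogonal_transformation_subspace_reflection[OF V]
    by (auto intro: orthogonal_transformation_linear orthogonal_transformation_inj)
  obtain vs where vs: "vs \<in> ordered_bases W" "\<tau> = same_orientation W `` {vs}"
    using \<tau> by (auto simp: orientations_def elim: quotientE)
  have "same_orientation (?r ` W) `` {map ?r ws} = map ?r ` \<tau>" if "ws \<in> \<tau>" for ws
  proof -
    have ws: "(vs, ws) \<in> same_orientation W" "ws \<in> ordered_bases W"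
      using that vs by (auto simp: same_orientation_iff)
    then have "\<tau> = same_orientation W `` {ws}"
      using vs(2) equiv_class_eq[OF equiv_same_orientation] by metis
    with same_orientation_image_class[OF r ws(2)] show ?thesis by simp
  qed
  moreover have "vs \<in> \<tau>"
    using vs equiv_class_self[OF equiv_same_orientation] by blast
  ultimately have "(\<Union>ws\<in>\<tau>. same_orientation (?r ` W) `` {map ?r ws}) = map ?r ` \<tau>"
    by blast
  then show ?thesis by (simp add: xy Grassmannian_op_def move_def)
qed

text \<open>Both sides move \<open>y\<close>, the left by \<open>g \<circ> r\<^sub>V\<close> and the right by \<open>r\<^bsub>g V\<^esub> \<circ> g\<close>, where \<open>V\<close> is the
  subspace of \<open>x\<close>; so this is the conjugation rule for reflections. With a reflection for \<open>g\<close> it is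
  self-distributivity of the operation.\<close>
lemma move_automorphism:
  fixes x y :: "'n::finite oriented_subspace"
  assumes g: "orthogonal_transformation g"
    and x: "x \<in> oriented_Grassmannian k" and y: "y \<in> oriented_Grassmannian l"
  shows "move g (Grassmannian_op x y) = Grassmannian_op (move g x) (move g y)"
proof -
  have g': "linear g" "inj g"
    using g by (auto intro: orthogonal_transformation_linear orthogonal_transformation_inj)
  have "subspace (fst x)" using x by (auto simp: oriented_Grassmannian_def)
  then have "move (g \<circ> subspace_reflection (fst x)) y
      = move (subspace_reflection (g ` fst x) \<circ> g) y"
    using g by (simp add: subspace_reflection_image)
  moreover have "fst (move g x) = g ` fst x" by (simp add: move_def split: prod.split)
  ultimately show ?thesis
    using x y g'
    by (simp add: Grassmannian_op_eq_move[of _ k _ l] move_move move_in_oriented_Grassmannian)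
qed

lemma
  assumes x: "x \<in> oriented_Grassmannian k" and y: "y \<in> oriented_Grassmannian l"
  shows Grassmannian_op_closed: "Grassmannian_op x y \<in> oriented_Grassmannian l"
    and Grassmannian_op_involution: "Grassmannian_op x (Grassmannian_op x y) = y"
proof -
  have V: "subspace (fst x)" using x by (auto simp: oriented_Grassmannian_def)
  let ?r = "subspace_reflection (fst x)"
  have r: "linear ?r" "inj ?r"
    using orthogonal_transformation_subspace_reflection[OF V]
    by (auto intro: orthogonal_transformation_linear orthogonal_transformation_inj)
  show closed: "Grassmannian_op x y \<in> oriented_Grassmannian l"
    using x y r by (simp add: Grassmannian_op_eq_move move_in_oriented_Grassmannian)
  show "Grassmannian_op x (Grassmannian_op x y) = y"
    using Grassmannian_op_eq_move[OF x y] Grassmannian_op_eq_move[OF x closed]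
    by (simp add: move_move subspace_reflection_involution[OF V])
      (simp add: move_def split: prod.split)
qed

lemma Grassmannian_op_self:
  assumes x: "x \<in> oriented_Grassmannian k"
  shows "Grassmannian_op x x = x"
proof -
  obtain V \<sigma> where V: "x = (V, \<sigma>)" "subspace V" "\<sigma> \<in> orientations V"
    using x by (auto simp: oriented_Grassmannian_def)
  have "map (subspace_reflection V) vs = vs" if "vs \<in> \<sigma>" for vs
  proof (rule map_idI)
    fix v assume "v \<in> set vs"
    moreover have "vs \<in> ordered_bases V"
      using V(3) that in_quotient_imp_subset[OF equiv_same_orientation]
      by (auto simp: orientations_def)
    ultimately have "v \<in> V"
      by (auto simp: ordered_bases_def intro: span_base)
    then show "subspace_reflection V v = v"
      using V(2) by (simp add: subspace_reflection_fixes)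
  qed
  then have "map (subspace_reflection V) ` \<sigma> = \<sigma>" by simp
  moreover have "subspace_reflection V ` V = V"
    using V(2) by (simp add: subspace_reflection_fixes)
  ultimately show ?thesis
    using Grassmannian_op_eq_move[OF x x] by (simp add: V(1) move_def)
qed

lemma quandle_oriented_Grassmannian: "quandle (oriented_Grassmannian k) Grassmannian_op"
  unfolding quandle_def
proof (intro conjI ballI)
  let ?G = "oriented_Grassmannian k :: 'a oriented_subspace set"
  fix x y z :: "'a oriented_subspace"
  assume x: "x \<in> ?G"
  show "Grassmannian_op x x = x" using x by (rule Grassmannian_op_self)
  show "bij_betw (Grassmannian_op x) ?G ?G"
    by (rule bij_betw_byWitness[where f' = "Grassmannian_op x"])
      (use x in \<open>auto simp: Grassmannian_op_closed Grassmannian_op_involution\<close>)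
  assume y: "y \<in> ?G" and z: "z \<in> ?G"
  have "subspace (fst x)" using x by (auto simp: oriented_Grassmannian_def)
  then have "move (subspace_reflection (fst x)) (Grassmannian_op y z)
      = Grassmannian_op (move (subspace_reflection (fst x)) y) (move (subspace_reflection (fst x)) z)"
    using y z by (intro move_automorphism orthogonal_transformation_subspace_reflection)
  then show "Grassmannian_op x (Grassmannian_op y z)
      = Grassmannian_op (Grassmannian_op x y) (Grassmannian_op x z)"
    using x y z Grassmannian_op_closed[OF y z] by (simp add: Grassmannian_op_eq_move[of x k _ k])
qed


section \<open>Coordinate subspaces\<close>

abbreviation coordinate_span :: "'n::finite set \<Rightarrow> (real^'n) set" where
  "coordinate_span I \<equiv> span ((\<lambda>i. axis i 1) ` I)"

lemma axis_image_subset_Basis: "(\<lambda>i. axis i (1::real)) ` I \<subseteq> Basis"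
  by (auto simp: Basis_vec_def)

lemma inj_axis: "inj (\<lambda>i::'n::finite. axis i (1::real))"
  by (rule injI) (simp add: axis_eq_axis)

lemma mem_coordinate_span: "x \<in> coordinate_span I \<longleftrightarrow> (\<forall>i. i \<notin> I \<longrightarrow> x $ i = 0)"
proof -
  have "x \<in> coordinate_span I \<longleftrightarrow> (\<forall>b\<in>Basis. b \<notin> (\<lambda>i. axis i 1) ` I \<longrightarrow> inner x b = 0)"
    by (simp add: span_substd_basis[OF axis_image_subset_Basis])
  also have "\<dots> \<longleftrightarrow> (\<forall>i. i \<notin> I \<longrightarrow> x $ i = 0)"
    by (auto simp: Basis_vec_def axis_eq_axis inner_axis)
  finally show ?thesis .
qed

lemma coordinate_span_inject: "coordinate_span I = coordinate_span J \<longleftrightarrow> I = J"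
proof
  have "i \<in> I \<longleftrightarrow> axis i 1 \<in> coordinate_span I" for i and I :: "'n::finite set"
    unfolding mem_coordinate_span by (auto simp: axis_def)
  then show "coordinate_span I = coordinate_span J \<Longrightarrow> I = J" by blast
qed simp

lemma ex_ordered_basis_coordinate_span:
  obtains vs where "vs \<in> ordered_bases (coordinate_span I)" "set vs = (\<lambda>i. axis i 1) ` I"
proof -
  obtain vs where "set vs = (\<lambda>i. axis i (1::real)) ` I" "distinct vs"
    using finite_distinct_list[of "(\<lambda>i. axis i (1::real)) ` I"] by auto
  moreover have "independent ((\<lambda>i. axis i (1::real)) ` I)"
    by (rule independent_substdbasis[OF axis_image_subset_Basis])
  ultimately show thesis
    by (intro that) (simp_all add: ordered_bases_def)
qed

lemma dim_coordinate_span: "dim (coordinate_span I) = card I"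
proof -
  have "dim ((\<lambda>i. axis i (1::real)) ` I) = card I"
    using dim_eq_card_independent[OF independent_substdbasis[OF axis_image_subset_Basis, of I]]
    by (simp add: card_image inj_on_subset[OF inj_axis])
  then show ?thesis by simp
qed

lemma coordinate_subspaces_subset: "coordinate_subspaces k \<subseteq> oriented_Grassmannian k"
  by (auto simp: coordinate_subspaces_def oriented_Grassmannian_def dim_coordinate_span
      simp del: dim_span)

lemma subspace_reflection_coordinate_span:
  "subspace_reflection (coordinate_span I) z = (\<chi> i. if i \<in> I then z $ i else - z $ i)"
proof -
  define x y where "x = (\<chi> i. if i \<in> I then z $ i else 0)" and "y = (\<chi> i. if i \<in> I then 0 else z $ i)"
  have "x \<in> coordinate_span I" by (simp add: mem_coordinate_span x_def)
  moreover have "y \<in> orthogonal_comp (coordinate_span I)"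
    by (auto simp: orthogonal_comp_def real_inner_class.orthogonal_def inner_vec_def
        mem_coordinate_span y_def intro!: sum.neutral)
  ultimately have "subspace_reflection (coordinate_span I) (x + y) = x - y"
    by (intro subspace_reflection_add) simp_all
  moreover have "x + y = z"
    by (simp add: Finite_Cartesian_Product.vec_eq_iff x_def y_def)
  moreover have "x - y = (\<chi> i. if i \<in> I then z $ i else - z $ i)"
    by (simp add: Finite_Cartesian_Product.vec_eq_iff x_def y_def)
  ultimately show ?thesis by simp
qed

lemma subspace_reflection_coordinate_span_image:
  "subspace_reflection (coordinate_span I) ` coordinate_span J = coordinate_span J"
proof -
  let ?r = "subspace_reflection (coordinate_span I)"
  have sub: "?r ` coordinate_span J \<subseteq> coordinate_span J"
    by (auto simp: subspace_reflection_coordinate_span mem_coordinate_span)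
  have "?r \<circ> ?r = id" by (intro subspace_reflection_involution) simp
  with image_mono[OF sub, of ?r] have "coordinate_span J \<subseteq> ?r ` coordinate_span J"
    by (simp add: image_comp)
  with sub show ?thesis by blast
qed

lemma coordinate_subspacesE:
  assumes "x \<in> coordinate_subspaces k"
  obtains I \<sigma> where "x = (coordinate_span I, \<sigma>)" "card I = k" "\<sigma> \<in> orientations (coordinate_span I)"
  using assms by (auto simp: coordinate_subspaces_def)

lemma Grassmannian_op_coordinate_subspace:
  assumes "card I = k" "\<sigma> \<in> orientations (coordinate_span I)" "y \<in> coordinate_subspaces l"
  shows "Grassmannian_op (coordinate_span I, \<sigma>) y = move (subspace_reflection (coordinate_span I)) y"
  using Grassmannian_op_eq_move[of "(coordinate_span I, \<sigma>)" k y l] assms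
    coordinate_subspaces_subset by (auto simp: coordinate_subspaces_def)

lemma move_in_coordinate_subspaces:
  assumes g: "linear g" "inj g" and \<pi>: "bij \<pi>" "\<And>I. g ` coordinate_span I = coordinate_span (\<pi> ` I)"
    and x: "x \<in> coordinate_subspaces k"
  shows "move g x \<in> coordinate_subspaces k"
proof -
  obtain I \<sigma> where I: "x = (coordinate_span I, \<sigma>)" "card I = k" "\<sigma> \<in> orientations (coordinate_span I)"
    using x by (rule coordinate_subspacesE)
  have "map g ` \<sigma> \<in> orientations (coordinate_span (\<pi> ` I))"
    using orientations_image[OF g I(3)] \<pi>(2) by simp
  moreover have "card (\<pi> ` I) = k"
    using I(2) \<pi>(1) by (simp add: card_image bij_is_inj inj_on_subset[OF _ subset_UNIV])
  ultimately show ?thesis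
    by (auto simp: move_def I(1) \<pi>(2) coordinate_subspaces_def)
qed

lemma Grassmannian_op_in_coordinate_subspaces:
  assumes x: "x \<in> coordinate_subspaces k" and y: "y \<in> coordinate_subspaces l"
  shows "Grassmannian_op x y \<in> coordinate_subspaces l" "fst (Grassmannian_op x y) = fst y"
proof -
  obtain I \<sigma> where I: "x = (coordinate_span I, \<sigma>)" "card I = k" "\<sigma> \<in> orientations (coordinate_span I)"
    using x by (rule coordinate_subspacesE)
  let ?r = "subspace_reflection (coordinate_span I)"
  have r: "linear ?r" "inj ?r"
    using orthogonal_transformation_subspace_reflection[OF subspace_span]
    by (auto intro: orthogonal_transformation_linear orthogonal_transformation_inj)
  have "move ?r y \<in> coordinate_subspaces l"
    by (rule move_in_coordinate_subspaces[OF r bij_id _ y])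
      (simp add: subspace_reflection_coordinate_span_image)
  moreover have op: "Grassmannian_op x y = move ?r y"
    using I y by (simp add: Grassmannian_op_coordinate_subspace)
  ultimately show "Grassmannian_op x y \<in> coordinate_subspaces l" by simp
  show "fst (Grassmannian_op x y) = fst y"
    using y by (auto simp: op move_def subspace_reflection_coordinate_span_image elim: coordinate_subspacesE)
qed

text \<open>The reflections in coordinate subspaces are diagonal matrices.\<close>
lemma Grassmannian_op_commute:
  assumes x: "x \<in> coordinate_subspaces k" and y: "y \<in> coordinate_subspaces l"
    and z: "z \<in> coordinate_subspaces m"
  shows "Grassmannian_op x (Grassmannian_op y z) = Grassmannian_op y (Grassmannian_op x z)"
proof -
  obtain I \<sigma> where I: "x = (coordinate_span I, \<sigma>)" "card I = k" "\<sigma> \<in> orientations (coordinate_span I)"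
    using x by (rule coordinate_subspacesE)
  obtain J \<tau> where J: "y = (coordinate_span J, \<tau>)" "card J = l" "\<tau> \<in> orientations (coordinate_span J)"
    using y by (rule coordinate_subspacesE)
  have comm: "subspace_reflection (coordinate_span I) \<circ> subspace_reflection (coordinate_span J)
      = subspace_reflection (coordinate_span J) \<circ> subspace_reflection (coordinate_span I)"
    by (simp add: fun_eq_iff subspace_reflection_coordinate_span Finite_Cartesian_Product.vec_eq_iff)
  have "Grassmannian_op y z = move (subspace_reflection (coordinate_span J)) z"
    "Grassmannian_op x z = move (subspace_reflection (coordinate_span I)) z"
    using I J z by (simp_all add: Grassmannian_op_coordinate_subspace)
  moreover have "Grassmannian_op x (Grassmannian_op y z)
      = move (subspace_reflection (coordinate_span I)) (Grassmannian_op y z)"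
    "Grassmannian_op y (Grassmannian_op x z)
      = move (subspace_reflection (coordinate_span J)) (Grassmannian_op x z)"
    using I J Grassmannian_op_in_coordinate_subspaces(1)[OF y z]
      Grassmannian_op_in_coordinate_subspaces(1)[OF x z]
    by (simp_all add: Grassmannian_op_coordinate_subspace)
  ultimately show ?thesis by (simp add: move_move comm)
qed

lemma subquandle_coordinate_subspaces:
  assumes k: "k \<le> CARD('n::finite)"
  shows "subquandle (coordinate_subspaces k :: 'n oriented_subspace set) (oriented_Grassmannian k) Grassmannian_op"
  unfolding subquandle_def
proof (intro conjI ballI)
  let ?A = "coordinate_subspaces k :: 'n oriented_subspace set" and ?G = "oriented_Grassmannian k :: 'n oriented_subspace set"
  show "quandle ?G Grassmannian_op" by (rule quandle_oriented_Grassmannian)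
  show AG: "?A \<subseteq> ?G" by (rule coordinate_subspaces_subset)
  obtain I :: "'n set" where "card I = k"
    using k obtain_subset_with_card_n[of k "UNIV :: 'n set"] by auto
  moreover obtain vs where "vs \<in> ordered_bases (coordinate_span I)"
    by (rule ex_ordered_basis_coordinate_span)
  ultimately have "(coordinate_span I, same_orientation (coordinate_span I) `` {vs}) \<in> ?A"
    by (auto simp: coordinate_subspaces_def orientations_def intro: quotientI)
  then show "?A \<noteq> {}" by blast
  fix a assume a: "a \<in> ?A"
  show "Grassmannian_op a ` ?A \<subseteq> ?A"
    using a by (auto simp: Grassmannian_op_in_coordinate_subspaces)
  have "inv_into ?G (Grassmannian_op a) y = Grassmannian_op a y" if "y \<in> ?A" for y
  proof (rule inv_into_f_eq)
    show "inj_on (Grassmannian_op a) ?G"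
      using quandle_oriented_Grassmannian[of k] a AG by (auto simp: quandle_def bij_betw_def)
    show "Grassmannian_op a y \<in> ?G" "Grassmannian_op a (Grassmannian_op a y) = y"
      using a that AG by (auto intro: Grassmannian_op_closed Grassmannian_op_involution)
  qed
  then show "inv_into ?G (Grassmannian_op a) ` ?A \<subseteq> ?A"
    using a by (auto simp: Grassmannian_op_in_coordinate_subspaces)
qed

section \<open>Subquandles and inner automorphisms of general quandles\<close>

lemma quandle_subquandle:
  assumes "subquandle A X s"
  shows "quandle A s"
  unfolding quandle_def
proof (intro conjI ballI)
  have X: "quandle X s" and AX: "A \<subseteq> X" and A: "\<And>a. a \<in> A \<Longrightarrow> s a ` A \<subseteq> A \<and> inv_into X (s a) ` A \<subseteq> A"
    using assms by (auto simp: subquandle_def)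
  fix a b c assume a: "a \<in> A"
  then show "s a a = a" using X AX by (auto simp: quandle_def)
  have bij: "bij_betw (s a) X X" using X AX a by (auto simp: quandle_def)
  have "inv_into X (s a) (s a y) = y" "s a (inv_into X (s a) y) = y" if "y \<in> A" for y
    using bij AX that by (auto simp: bij_betw_inv_into_left bij_betw_inv_into_right)
  then show "bij_betw (s a) A A"
    using A[OF a] by (intro bij_betw_byWitness[where f' = "inv_into X (s a)"]) blast+
  assume "b \<in> A" "c \<in> A"
  with a AX have "a \<in> X" "b \<in> X" "c \<in> X" by auto
  with X show "s a (s b c) = s (s a b) (s a c)"
    unfolding quandle_def by blast
qed

lemma quandle_translation_in_Bij:
  "quandle X s \<Longrightarrow> x \<in> X \<Longrightarrow> restrict (s x) X \<in> Bij X"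
  by (auto simp: quandle_def Bij_def)

lemma quandle_Inn_group:
  assumes "quandle X s"
  shows "group (quandle_Inn X s)"
proof -
  interpret group "BijGroup X" by (rule group_BijGroup)
  have "subgroup (generate (BijGroup X) ((\<lambda>x. restrict (s x) X) ` X)) (BijGroup X)"
    using assms by (intro generate_is_subgroup)
      (auto simp: BijGroup_def intro: quandle_translation_in_Bij)
  then show ?thesis
    unfolding quandle_Inn_def by (rule subgroup_imp_group)
qed

text \<open>The elements commuting with \<open>a\<close> form a subgroup.\<close>
lemma (in group) generate_commute_element:
  assumes H: "H \<subseteq> carrier G" and g: "g \<in> generate G H" and a: "a \<in> carrier G"
    and comm: "\<And>h. h \<in> H \<Longrightarrow> h \<otimes> a = a \<otimes> h"
  shows "g \<otimes> a = a \<otimes> g"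
  using g
proof induction
  case one then show ?case using a by simp
next
  case (incl h) then show ?case by (rule comm)
next
  case (inv h)
  then have h: "h \<in> carrier G" using H by blast
  have "inv h \<otimes> a = inv h \<otimes> (a \<otimes> h) \<otimes> inv h"
    using a h by (simp add: m_assoc)
  also have "\<dots> = inv h \<otimes> (h \<otimes> a) \<otimes> inv h" using comm[OF inv] by simp
  also have "\<dots> = a \<otimes> inv h" using a h by (simp add: m_assoc[symmetric])
  finally show ?case .
next
  case (eng g h)
  then have "g \<in> carrier G" "h \<in> carrier G" using generate_in_carrier[OF H] by auto
  with eng a show ?case by (metis m_assoc)
qed

lemma (in group) generate_commute:
  assumes H: "H \<subseteq> carrier G" and comm: "\<And>g h. g \<in> H \<Longrightarrow> h \<in> H \<Longrightarrow> g \<otimes> h = h \<otimes> g"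
    and "g \<in> generate G H" "h \<in> generate G H"
  shows "g \<otimes> h = h \<otimes> g"
proof (rule generate_commute_element[OF H])
  show "g \<in> generate G H" "h \<in> carrier G"
    using assms generate_in_carrier[OF H] by auto
  show "g' \<otimes> h = h \<otimes> g'" if "g' \<in> H" for g'
    using generate_commute_element[OF H \<open>h \<in> generate G H\<close>, of g'] comm that H by auto
qed

text \<open>A group is abelian as soon as its generators commute.\<close>
lemma comm_group_quandle_Inn:
  assumes X: "quandle X s"
    and comm: "\<And>x y z. x \<in> X \<Longrightarrow> y \<in> X \<Longrightarrow> z \<in> X \<Longrightarrow> s x (s y z) = s y (s x z)"
  shows "comm_group (quandle_Inn X s)"
proof -
  interpret B: group "BijGroup X" by (rule group_BijGroup)
  let ?S = "(\<lambda>x. restrict (s x) X) ` X"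
  have S: "?S \<subseteq> carrier (BijGroup X)"
    using X by (auto simp: BijGroup_def intro: quandle_translation_in_Bij)
  have closed: "s x z \<in> X" if "x \<in> X" "z \<in> X" for x z
    using X that by (auto simp: quandle_def bij_betw_def)
  have S_comm: "g \<otimes>\<^bsub>BijGroup X\<^esub> h = h \<otimes>\<^bsub>BijGroup X\<^esub> g" if gh: "g \<in> ?S" "h \<in> ?S" for g h
  proof -
    have "g \<in> Bij X" "h \<in> Bij X" using gh S by (auto simp: BijGroup_def)
    moreover have "compose X g h = compose X h g"
      using gh comm closed by (auto simp: compose_def fun_eq_iff)
    ultimately show ?thesis by (simp add: BijGroup_def)
  qed
  show ?thesis
    by (rule group.group_comm_groupI[OF quandle_Inn_group[OF X]])
      (use B.generate_commute[OF S S_comm] in \<open>simp add: quandle_Inn_def\<close>)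
qed

text \<open>A function \<open>\<Phi>\<close> that is invariant under the generators is constant on the orbits of the inner
  automorphism group, so two values of \<open>\<Phi>\<close> separate two orbits.\<close>
lemma quandle_disconnectedI:
  assumes X: "quandle X s" and inv: "\<And>x y. x \<in> X \<Longrightarrow> y \<in> X \<Longrightarrow> \<Phi> (s x y) = \<Phi> y"
    and xy: "x \<in> X" "y \<in> X" "\<Phi> x \<noteq> \<Phi> y"
  shows "quandle_disconnected X s"
proof
  interpret B: group "BijGroup X" by (rule group_BijGroup)
  let ?S = "(\<lambda>x. restrict (s x) X) ` X"
  have S: "?S \<subseteq> Bij X" using X by (auto intro: quandle_translation_in_Bij)
  then have S': "?S \<subseteq> carrier (BijGroup X)" by (simp add: BijGroup_def)
  have "\<forall>z\<in>X. \<Phi> (g z) = \<Phi> z" if "g \<in> generate (BijGroup X) ?S" for g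
    using that
  proof induction
    case one then show ?case by (simp add: BijGroup_def)
  next
    case (incl h) then show ?case using inv by auto
  next
    case (inv h)
    then have h: "h \<in> Bij X" "\<And>z. z \<in> X \<Longrightarrow> \<Phi> (h z) = \<Phi> z"
      using S assms(2) by auto
    show ?case
    proof
      fix z assume z: "z \<in> X"
      \<comment> \<open>Invariance under \<open>h\<close>, used at the preimage of \<open>z\<close>, is invariance under the inverse.\<close>
      have "h (inv_into X h z) = z" "inv_into X h z \<in> X"
        using h(1) z by (auto simp: Bij_def bij_betw_inv_into_right intro: Bij_inv_into_mem[OF h(1)])
      with h(2) have "\<Phi> (inv_into X h z) = \<Phi> z" by metis
      with h(1) z show "\<Phi> ((inv\<^bsub>BijGroup X\<^esub> h) z) = \<Phi> z" by (simp add: inv_BijGroup)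
    qed
  next
    case (eng g h)
    then have "g \<in> Bij X" "h \<in> Bij X"
      using B.generate_in_carrier[OF S' eng.hyps(1)] B.generate_in_carrier[OF S' eng.hyps(2)]
      by (simp_all add: BijGroup_def)
    with eng.IH show ?case by (auto simp: BijGroup_def compose_def Bij_imp_funcset[THEN funcset_mem])
  qed
  moreover assume "quandle_connected X s"
  then obtain g where "g \<in> generate (BijGroup X) ?S" "g x = y"
    using xy by (auto simp: quandle_connected_def transitive_on_def quandle_Inn_def)
  ultimately show False using xy by auto
qed


section \<open>The two orientations of a coordinate subspace\<close>

text \<open>In the next three lemmas \<open>h\<close> reverses the first basis vector and fixes the others. Its
  effect on a change of basis is to negate the first row of the matrix, and thereby its
  determinant.\<close>
lemma basis_change_flip:
  assumes M: "M \<in> carrier_mat (length vs) (length vs)"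
    and h: "\<And>i. i < length vs \<Longrightarrow> h (vs ! i) = (if i = 0 then - vs ! i else vs ! i)"
  shows "basis_change (map h vs) M = basis_change vs (multrow 0 (- 1) M)"
proof (rule nth_equalityI)
  fix j assume "j < length (basis_change (map h vs) M)"
  then have j: "j < length vs" by simp
  then show "basis_change (map h vs) M ! j = basis_change vs (multrow 0 (- 1) M) ! j"
    using M by (simp add: nth_basis_change) (intro sum.cong, auto simp: h)
qed simp

lemma flip_not_same_orientation:
  assumes vs: "vs \<in> ordered_bases V" "vs \<noteq> []"
    and h: "\<And>i. i < length vs \<Longrightarrow> h (vs ! i) = (if i = 0 then - vs ! i else vs ! i)"
  shows "(vs, map h vs) \<notin> same_orientation V"
proof
  have len: "length vs = dim V" using vs(1) by (rule length_ordered_bases)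
  have one: "1\<^sub>m (dim V) \<in> carrier_mat (dim V) (dim V)" by simp
  have D: "map h vs = basis_change vs (multrow 0 (- 1) (1\<^sub>m (dim V)))"
    using basis_change_flip[where vs = vs and h = h and M = "1\<^sub>m (dim V)"] h
      basis_change_one[of "map h vs"] by (simp add: len)
  assume "(vs, map h vs) \<in> same_orientation V"
  then obtain M where M: "M \<in> carrier_mat (dim V) (dim V)" "map h vs = basis_change vs M"
    "Determinant.det M > 0"
    by (auto simp: same_orientation_iff)
  have "M = multrow 0 (- 1) (1\<^sub>m (dim V))"
    using basis_change_inject[of vs M "multrow 0 (- 1) (1\<^sub>m (dim V))"] D M(1,2) vs(1) len
    by (simp add: ordered_bases_def)
  moreover have "0 < dim V" using vs(2) len by (metis length_greater_0_conv)
  ultimately have "Determinant.det M = - 1"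
    using det_multrow[OF _ one, of 0 "- 1"] by simp
  with M(3) show False by simp
qed

lemma same_orientation_or_flip:
  assumes vs: "vs \<in> ordered_bases V" "vs \<noteq> []" and ws: "ws \<in> ordered_bases V"
    and hvs: "map h vs \<in> ordered_bases V"
    and h: "\<And>i. i < length vs \<Longrightarrow> h (vs ! i) = (if i = 0 then - vs ! i else vs ! i)"
  shows "(vs, ws) \<in> same_orientation V \<or> (map h vs, ws) \<in> same_orientation V"
proof -
  have len: "length vs = dim V" using vs(1) by (rule length_ordered_bases)
  then have dim: "0 < dim V" using vs(2) by (metis length_greater_0_conv)
  obtain M N where M: "M \<in> carrier_mat (dim V) (dim V)" "ws = basis_change vs M"
    and "Determinant.det M * Determinant.det N = 1"
    using ordered_bases_basis_change[OF vs(1) ws] by metis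
  then consider "Determinant.det M > 0" | "Determinant.det M < 0"
    by (metis linorder_neqE_linordered_idom mult_zero_left zero_neq_one)
  then show ?thesis
  proof cases
    case 1
    with M vs ws show ?thesis by (auto simp: same_orientation_iff)
  next
    case 2
    let ?M = "multrow 0 (- 1) M"
    have M': "?M \<in> carrier_mat (dim V) (dim V)" using M(1) by simp
    have "multrow 0 (- 1) ?M = M" using M(1) by (intro eq_matI) auto
    then have "ws = basis_change (map h vs) ?M"
      using basis_change_flip[where vs = vs and h = h and M = ?M] h M(2) M' len by simp
    moreover have "Determinant.det ?M > 0"
      using 2 det_multrow[OF dim M(1), of "- 1"] by simp
    ultimately show ?thesis using M' ws hvs by (auto simp: same_orientation_iff)
  qed
qed

text \<open>A nonzero coordinate subspace has exactly two orientations, exchanged by a single reflection.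
  The exchanging map is itself taken to be a coordinate reflection, the sign change of one
  coordinate \<open>j \<in> J\<close>, so that it preserves all coordinate subspaces and can later correct an
  orientation without disturbing anything else.\<close>
lemma coordinate_span_orientations:
  fixes J :: "'n::finite set"
  assumes "J \<noteq> {}"
  obtains K :: "'n set" and \<sigma>\<^sub>0
    where "\<sigma>\<^sub>0 \<in> orientations (coordinate_span J)"
      and "map (subspace_reflection (coordinate_span K)) ` \<sigma>\<^sub>0 \<noteq> \<sigma>\<^sub>0"
      and "\<And>\<sigma> \<tau>. \<sigma> \<in> orientations (coordinate_span J) \<Longrightarrow> \<tau> \<in> orientations (coordinate_span J) \<Longrightarrow>
        \<tau> = \<sigma> \<or> \<tau> = map (subspace_reflection (coordinate_span K)) ` \<sigma>"
proof -
  let ?V = "coordinate_span J"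
  obtain vs where vs: "vs \<in> ordered_bases ?V" "set vs = (\<lambda>i. axis i 1) ` J"
    by (rule ex_ordered_basis_coordinate_span)
  have ne: "vs \<noteq> []" using vs(2) assms by auto
  then have "vs ! 0 \<in> (\<lambda>i. axis i 1) ` J" using vs(2) by (metis length_greater_0_conv nth_mem)
  then obtain j where j: "vs ! 0 = axis j 1" by auto
  let ?h = "subspace_reflection (coordinate_span (- {j}))"
  have h: "?h (vs ! i) = (if i = 0 then - vs ! i else vs ! i)" if i: "i < length vs" for i
  proof (cases "i = 0")
    case True
    have "?h (axis j 1) = - axis j 1"
      unfolding subspace_reflection_coordinate_span
      by (simp add: Finite_Cartesian_Product.vec_eq_iff axis_def)
    with True show ?thesis by (simp add: j)
  next
    case False
    obtain l where l: "vs ! i = axis l 1" using i vs(2) nth_mem by blast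
    have "vs ! i \<noteq> vs ! 0"
      using vs(1) i ne False by (auto simp: ordered_bases_def nth_eq_iff_index_eq)
    then have "l \<noteq> j" using l j by auto
    then have "?h (axis l 1) = axis l 1"
      unfolding subspace_reflection_coordinate_span
      by (simp add: Finite_Cartesian_Product.vec_eq_iff axis_def)
    with False show ?thesis by (simp add: l)
  qed
  have lin: "linear ?h" "inj ?h"
    using orthogonal_transformation_subspace_reflection[OF subspace_span]
    by (auto intro: orthogonal_transformation_linear orthogonal_transformation_inj)
  have hvs: "map ?h vs \<in> ordered_bases ?V"
    using ordered_bases_image[OF lin vs(1)] by (simp add: subspace_reflection_coordinate_span_image)
  define \<sigma>\<^sub>0 where "\<sigma>\<^sub>0 = same_orientation ?V `` {vs}"
  have h\<sigma>\<^sub>0: "map ?h ` \<sigma>\<^sub>0 = same_orientation ?V `` {map ?h vs}"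
    using same_orientation_image_class[OF lin vs(1)]
    by (simp add: \<sigma>\<^sub>0_def subspace_reflection_coordinate_span_image)
  have "?h \<circ> ?h = id" by (intro subspace_reflection_involution subspace_span)
  then have hh: "map ?h ` map ?h ` \<sigma>\<^sub>0 = \<sigma>\<^sub>0" by (simp add: image_comp)
  have two: "\<sigma> = \<sigma>\<^sub>0 \<or> \<sigma> = map ?h ` \<sigma>\<^sub>0" if "\<sigma> \<in> orientations ?V" for \<sigma>
  proof -
    obtain ws where ws: "ws \<in> ordered_bases ?V" "\<sigma> = same_orientation ?V `` {ws}"
      using \<open>\<sigma> \<in> orientations ?V\<close> by (auto simp: orientations_def elim: quotientE)
    have "(vs, ws) \<in> same_orientation ?V \<or> (map ?h vs, ws) \<in> same_orientation ?V"
      by (rule same_orientation_or_flip[OF vs(1) ne ws(1) hvs h])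
    then show ?thesis
      unfolding ws(2) h\<sigma>\<^sub>0 unfolding \<sigma>\<^sub>0_def by (metis equiv_class_eq[OF equiv_same_orientation])
  qed
  show thesis
  proof (rule that)
    show "\<sigma>\<^sub>0 \<in> orientations ?V"
      using vs(1) by (simp add: \<sigma>\<^sub>0_def orientations_def quotientI)
    have "(vs, map ?h vs) \<notin> same_orientation ?V"
      by (rule flip_not_same_orientation[OF vs(1) ne h])
    moreover have "map ?h vs \<in> map ?h ` \<sigma>\<^sub>0"
      using equiv_class_self[OF equiv_same_orientation hvs] by (simp only: h\<sigma>\<^sub>0)
    ultimately show "map ?h ` \<sigma>\<^sub>0 \<noteq> \<sigma>\<^sub>0" by (auto simp: \<sigma>\<^sub>0_def)
    show "\<tau> = \<sigma> \<or> \<tau> = map ?h ` \<sigma>" if "\<sigma> \<in> orientations ?V" "\<tau> \<in> orientations ?V" for \<sigma> \<tau>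
      using two[OF that(1)] two[OF that(2)] hh by metis
  qed
qed

section \<open>Homogeneity\<close>

definition permute_coordinates :: "('n::finite \<Rightarrow> 'n) \<Rightarrow> real^'n \<Rightarrow> real^'n" where
  "permute_coordinates \<pi> x = (\<chi> i. x $ inv_into UNIV \<pi> i)"

lemma orthogonal_transformation_permute_coordinates:
  assumes "bij \<pi>"
  shows "orthogonal_transformation (permute_coordinates \<pi>)"
  unfolding orthogonal_transformation_def
proof (intro conjI allI linearI)
  fix x y :: "real^'a" and c :: real
  show "permute_coordinates \<pi> (x + y) = permute_coordinates \<pi> x + permute_coordinates \<pi> y"
    "permute_coordinates \<pi> (c *\<^sub>R x) = c *\<^sub>R permute_coordinates \<pi> x"
    by (simp_all add: permute_coordinates_def Finite_Cartesian_Product.vec_eq_iff)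
  show "inner (permute_coordinates \<pi> x) (permute_coordinates \<pi> y) = inner x y"
    using sum.reindex_bij_betw[OF bij_imp_bij_inv[OF assms], of "\<lambda>i. x $ i * y $ i"]
    by (simp add: inner_vec_def permute_coordinates_def)
qed

lemma permute_coordinates_coordinate_span:
  assumes \<pi>: "bij \<pi>"
  shows "permute_coordinates \<pi> ` coordinate_span I = coordinate_span (\<pi> ` I)"
proof
  have inv: "inv_into UNIV \<pi> i \<in> I \<longleftrightarrow> i \<in> \<pi> ` I" for i
    using \<pi> by (metis bij_inv_eq_iff image_iff)
  then show "permute_coordinates \<pi> ` coordinate_span I \<subseteq> coordinate_span (\<pi> ` I)"
    by (auto simp: mem_coordinate_span permute_coordinates_def)
  show "coordinate_span (\<pi> ` I) \<subseteq> permute_coordinates \<pi> ` coordinate_span I"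
  proof
    fix x assume x: "x \<in> coordinate_span (\<pi> ` I)"
    let ?y = "\<chi> i. x $ \<pi> i"
    have "?y \<in> coordinate_span I"
      using x \<pi> by (auto simp: mem_coordinate_span bij_is_inj inj_image_mem_iff)
    moreover have "x = permute_coordinates \<pi> ?y"
      using \<pi> by (simp add: permute_coordinates_def Finite_Cartesian_Product.vec_eq_iff
          bij_is_surj surj_f_inv_f)
    ultimately show "x \<in> permute_coordinates \<pi> ` coordinate_span I" by blast
  qed
qed

lemma ex_bij_image_eq:
  fixes I J :: "'a::finite set"
  assumes "card I = card J"
  obtains \<pi> where "bij \<pi>" "\<pi> ` I = J"
proof -
  obtain f where f: "bij_betw f I J"
    using assms finite_same_card_bij[of I J] by auto
  have "card (- I) = card (- J)" using assms by (simp add: Compl_eq_Diff_UNIV card_Diff_subset)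
  then obtain g where g: "bij_betw g (- I) (- J)"
    using finite_same_card_bij[of "- I" "- J"] by auto
  let ?\<pi> = "\<lambda>x. if x \<in> I then f x else g x"
  have "bij ?\<pi>"
    using bij_betw_disjoint_Un[OF f g] by (simp add: Compl_partition)
  moreover have "?\<pi> ` I = J" using f by (auto simp: bij_betw_def)
  ultimately show thesis by (rule that)
qed

lemma move_in_quandle_Aut:
  fixes g :: "real^'n \<Rightarrow> real^'n"
  assumes g: "orthogonal_transformation g"
    and \<pi>: "bij \<pi>" "\<And>I. g ` coordinate_span I = coordinate_span (\<pi> ` I)"
  shows "restrict (move g) (coordinate_subspaces k)
    \<in> carrier (quandle_Aut (coordinate_subspaces k) Grassmannian_op)"
proof -
  let ?A = "coordinate_subspaces k"
  have g': "linear g" "inj g" "bij g"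
    using g by (auto intro: orthogonal_transformation_linear orthogonal_transformation_inj
        orthogonal_transformation_bij)
  have i': "linear (inv_into UNIV g)" "inj (inv_into UNIV g)"
    using orthogonal_transformation_inv[OF g]
    by (auto intro: orthogonal_transformation_linear orthogonal_transformation_inj)
  have gi: "g \<circ> inv_into UNIV g = id" "inv_into UNIV g \<circ> g = id"
    using g'(2) bij_is_surj[OF g'(3)] surj_iff[of g] inv_o_cancel[of g] by blast+
  have "inv_into UNIV g ` coordinate_span I = coordinate_span (inv_into UNIV \<pi> ` I)" for I
  proof -
    have "coordinate_span I = g ` coordinate_span (inv_into UNIV \<pi> ` I)"
      using \<pi> by (simp add: bij_is_surj image_f_inv_f)
    then show ?thesis using g'(2) by (simp add: image_inv_f_f)
  qed
  then have inv: "move (inv_into UNIV g) x \<in> ?A" if "x \<in> ?A" for x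
    using that by (intro move_in_coordinate_subspaces[OF i' bij_imp_bij_inv[OF \<pi>(1)]])
  have closed: "move g x \<in> ?A" if "x \<in> ?A" for x
    using that by (intro move_in_coordinate_subspaces[OF g'(1,2) \<pi>])
  have move_id: "move id x = x" for x :: "'n oriented_subspace"
    by (simp add: move_def split: prod.split)
  have "bij_betw (move g) ?A ?A"
    by (rule bij_betw_byWitness[where f' = "move (inv_into UNIV g)"])
      (auto simp: move_move gi move_id inv closed)
  moreover have "quandle_hom ?A Grassmannian_op ?A Grassmannian_op (restrict (move g) ?A)"
    unfolding quandle_hom_def
  proof (intro conjI ballI)
    fix x y :: "'n oriented_subspace"
    assume xy: "x \<in> ?A" "y \<in> ?A"
    then have "move g (Grassmannian_op x y) = Grassmannian_op (move g x) (move g y)"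
      using coordinate_subspaces_subset by (intro move_automorphism[OF g]) blast+
    with xy show "restrict (move g) ?A (Grassmannian_op x y)
        = Grassmannian_op (restrict (move g) ?A x) (restrict (move g) ?A y)"
      by (simp add: Grassmannian_op_in_coordinate_subspaces)
  qed (use closed in auto)
  ultimately show ?thesis
    by (simp add: quandle_Aut_def Bij_def)
qed

text \<open>A permutation of the coordinates brings \<open>I\<close> to \<open>J\<close>; one sign change then repairs the
  orientation if necessary.\<close>
lemma quandle_homogeneous_coordinate_subspaces:
  assumes k: "1 \<le> k"
  shows "quandle_homogeneous (coordinate_subspaces k) Grassmannian_op"
  unfolding quandle_homogeneous_def transitive_on_def
proof (intro ballI)
  fix x y :: "'n::finite oriented_subspace"
  assume x: "x \<in> coordinate_subspaces k" and y: "y \<in> coordinate_subspaces k"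
  obtain I \<sigma> where I: "x = (coordinate_span I, \<sigma>)" "card I = k" "\<sigma> \<in> orientations (coordinate_span I)"
    using x by (rule coordinate_subspacesE)
  obtain J \<tau> where J: "y = (coordinate_span J, \<tau>)" "card J = k" "\<tau> \<in> orientations (coordinate_span J)"
    using y by (rule coordinate_subspacesE)
  obtain \<pi> where \<pi>: "bij \<pi>" "\<pi> ` I = J"
    using ex_bij_image_eq[of I J] I(2) J(2) by auto
  let ?P = "permute_coordinates \<pi>"
  have P: "orthogonal_transformation ?P"
    using \<pi>(1) by (rule orthogonal_transformation_permute_coordinates)
  have P_span: "?P ` coordinate_span L = coordinate_span (\<pi> ` L)" for L
    using \<pi>(1) by (rule permute_coordinates_coordinate_span)
  have \<sigma>': "map ?P ` \<sigma> \<in> orientations (coordinate_span J)"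
    using orientations_image[OF _ _ I(3), of ?P] P P_span[of I] \<pi>(2)
    by (auto intro: orthogonal_transformation_linear orthogonal_transformation_inj)
  have "J \<noteq> {}" using J(2) k by auto
  then obtain K where K: "\<tau> = map ?P ` \<sigma> \<or> \<tau> = map (subspace_reflection (coordinate_span K)) ` map ?P ` \<sigma>"
    using coordinate_span_orientations[of J] \<sigma>' J(3) by metis
  let ?h = "subspace_reflection (coordinate_span K)"
  have "\<exists>g. orthogonal_transformation g \<and> (\<forall>L. g ` coordinate_span L = coordinate_span (\<pi> ` L))
      \<and> map g ` \<sigma> = \<tau>"
    using K
  proof
    assume "\<tau> = map ?P ` \<sigma>"
    with P P_span show ?thesis by blast
  next
    assume "\<tau> = map ?h ` map ?P ` \<sigma>"
    then have "map (?h \<circ> ?P) ` \<sigma> = \<tau>" by (simp add: image_comp)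
    moreover have "orthogonal_transformation (?h \<circ> ?P)"
      by (intro orthogonal_transformation_compose P
          orthogonal_transformation_subspace_reflection subspace_span)
    moreover have "(?h \<circ> ?P) ` coordinate_span L = coordinate_span (\<pi> ` L)" for L
      unfolding image_comp[symmetric] P_span by (rule subspace_reflection_coordinate_span_image)
    ultimately show ?thesis by blast
  qed
  then obtain g where g: "orthogonal_transformation g"
    "\<And>L. g ` coordinate_span L = coordinate_span (\<pi> ` L)" "map g ` \<sigma> = \<tau>"
    by blast
  then have "restrict (move g) (coordinate_subspaces k) x = y"
    using x by (simp add: I(1) J(1) move_def \<pi>(2))
  with move_in_quandle_Aut[OF g(1) \<pi>(1) g(2)]
  show "\<exists>f\<in>carrier (quandle_Aut (coordinate_subspaces k) Grassmannian_op). f x = y" by blast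
qed

section \<open>Disconnectedness\<close>

text \<open>The invariant separating two orbits is the underlying subspace if \<open>k < n\<close>. If \<open>k = n\<close>, the
  operation is trivial, so the invariant may be the point itself, and the two orientations of the
  whole space are different points.\<close>
lemma quandle_disconnected_coordinate_subspaces:
  assumes k: "1 \<le> k" "k \<le> CARD('n::finite)"
    and A: "quandle (coordinate_subspaces k :: 'n oriented_subspace set) Grassmannian_op"
  shows "quandle_disconnected (coordinate_subspaces k :: 'n oriented_subspace set) Grassmannian_op"
proof (cases "k = CARD('n)")
  case True
  obtain K :: "'n set" and \<sigma>\<^sub>0 where \<sigma>\<^sub>0: "\<sigma>\<^sub>0 \<in> orientations (coordinate_span (UNIV :: 'n set))"
    "map (subspace_reflection (coordinate_span K)) ` \<sigma>\<^sub>0 \<noteq> \<sigma>\<^sub>0"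
    using coordinate_span_orientations[of "UNIV :: 'n set"] by (metis UNIV_not_empty)
  let ?h = "subspace_reflection (coordinate_span K)"
  have "map ?h ` \<sigma>\<^sub>0 \<in> orientations (?h ` coordinate_span UNIV)"
    using orthogonal_transformation_subspace_reflection[OF subspace_span]
    by (intro orientations_image \<sigma>\<^sub>0(1))
      (auto intro: orthogonal_transformation_linear orthogonal_transformation_inj)
  then have \<sigma>\<^sub>1: "map ?h ` \<sigma>\<^sub>0 \<in> orientations (coordinate_span UNIV)"
    by (simp only: subspace_reflection_coordinate_span_image)
  show ?thesis
  proof (rule quandle_disconnectedI[OF A, where \<Phi> = "\<lambda>x. x"])
    show "(coordinate_span UNIV, \<sigma>\<^sub>0) \<in> coordinate_subspaces k"
      "(coordinate_span UNIV, map ?h ` \<sigma>\<^sub>0) \<in> coordinate_subspaces k"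
      using True \<sigma>\<^sub>0(1) \<sigma>\<^sub>1 unfolding coordinate_subspaces_def by blast+
    show "(coordinate_span UNIV, \<sigma>\<^sub>0) \<noteq> (coordinate_span UNIV, map ?h ` \<sigma>\<^sub>0)"
      using \<sigma>\<^sub>0(2) by auto
    fix x y :: "'n oriented_subspace"
    assume x: "x \<in> coordinate_subspaces k" and y: "y \<in> coordinate_subspaces k"
    obtain I \<sigma> where I: "x = (coordinate_span I, \<sigma>)" "card I = k" "\<sigma> \<in> orientations (coordinate_span I)"
      using x by (rule coordinate_subspacesE)
    have "I = UNIV" using I(2) True by (simp add: card_eq_UNIV_imp_eq_UNIV)
    then have "subspace_reflection (coordinate_span I) = id"
      by (simp add: fun_eq_iff subspace_reflection_coordinate_span)
    then show "Grassmannian_op x y = y"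
      using Grassmannian_op_coordinate_subspace[OF I(2,3) y]
      by (simp add: I(1) move_def split: prod.split)
  qed
next
  case False
  obtain I :: "'n set" where I: "card I = k"
    using k obtain_subset_with_card_n[of k "UNIV :: 'n set"] by auto
  \<comment> \<open>Exchanging one index gives a second index set of the same size.\<close>
  have "I \<noteq> {}" "I \<noteq> UNIV" using I k False by auto
  then obtain i j where ij: "i \<in> I" "j \<notin> I" by blast
  define J where "J = insert j (I - {i})"
  have "card (I - {i}) = k - 1" using I ij by simp
  then have J: "card J = k" "J \<noteq> I" using ij k(1) by (auto simp: J_def)
  have ex: "\<exists>\<sigma>. (coordinate_span L, \<sigma>) \<in> coordinate_subspaces k" if "card L = k" for L :: "'n set"
  proof -
    have "L \<noteq> {}" using that k by auto
    then obtain \<sigma> where "\<sigma> \<in> orientations (coordinate_span L)"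
      by (rule coordinate_span_orientations)
    with that show ?thesis unfolding coordinate_subspaces_def by blast
  qed
  obtain \<sigma> \<tau> where x: "(coordinate_span I, \<sigma>) \<in> coordinate_subspaces k"
      "(coordinate_span J, \<tau>) \<in> coordinate_subspaces k"
    using ex[OF I] ex[OF J(1)] by blast
  show ?thesis
    by (rule quandle_disconnectedI[OF A, where \<Phi> = fst, OF _ x])
      (use J(2) in \<open>auto simp: Grassmannian_op_in_coordinate_subspaces coordinate_span_inject\<close>)
qed

theorem theorem1p2:
  fixes k :: nat
    and A G :: "'n::finite oriented_subspace set"
  assumes "1 \<le> k" and "k \<le> CARD('n)"
  defines "A \<equiv> coordinate_subspaces k"
    and "G \<equiv> oriented_Grassmannian k"
  shows "subquandle A G Grassmannian_op \<and>
    quandle A Grassmannian_op \<and>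
    quandle_homogeneous A Grassmannian_op \<and>
    quandle_disconnected A Grassmannian_op \<and>
    comm_group (quandle_Inn A Grassmannian_op)"
proof -
  have sub: "subquandle A G Grassmannian_op"
    unfolding A_def G_def using assms(2) by (rule subquandle_coordinate_subspaces)
  then have A: "quandle A Grassmannian_op" by (rule quandle_subquandle)
  have "quandle_homogeneous A Grassmannian_op"
    unfolding A_def using assms(1) by (rule quandle_homogeneous_coordinate_subspaces)
  moreover have "quandle_disconnected A Grassmannian_op"
    using assms(1,2) A unfolding A_def by (rule quandle_disconnected_coordinate_subspaces)
  moreover have "comm_group (quandle_Inn A Grassmannian_op)"
    using A by (rule comm_group_quandle_Inn) (unfold A_def, rule Grassmannian_op_commute)
  ultimately show ?thesis using sub A by blast
qed

end
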